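(* Let $n\ge 1$ and consider a single weighing of coins from a set of $n$ coins weighing $1,2,\ldots,n$ grams. This one weighing determines the weight of some coin if and only if all of the following hold: (1) one cup of the weighing consists of exactly the coins with weights from $1$ to $i$, for some $i$; (2) the other cup consists of exactly the coins with weights from $j$ to $n$, for some $j$; (3) either the scale balances, or the cup containing the $1$-gram coin is lighter by exactly one gram; and (4) at least one cup contains exactly one coin, or exactly one coin is left off the scale.
   Context: There are $n$ coins weighing $1,2,\ldots,n$ grams (one of each weight). Identify each coin with its true weight, so the coins are the elements of $\{1,\ldots,n\}$. A weighing on a balance scale is an ordered pair $(L,R)$ of disjoint nonempty subsets of $\{1,\ldots,n\}$ (the coins in the left and right cups); its outcome is whether $\sum_{x\in L}x$ is less than, equal to, or greater than $\sum_{x\in R}x$. The audience knows only that the weights are $1,\ldots,n$ in some order, which coins lie on which cup or off the scale, and the outcome. A weighing $(L,R)$ determines (confirms) the weight of coin $k$ if every permutation $\sigma$ of $\{1,\ldots,n\}$ for which $\sum_{x\in L}\sigma(x)-\sum_{x\in R}\sigma(x)$ has the same sign (negative, zero or positive) as $\sum_{x\in L}x-\sum_{x\in R}x$ satisfies $\sigma(k)=k$. *)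

theory Defs
  imports Main "HOL-Combinatorics.Permutations"
begin

definition weighing :: "nat \<Rightarrow> nat set \<Rightarrow> nat set \<Rightarrow> bool" where
  "weighing n L R \<longleftrightarrow>
     L \<subseteq> {1..n} \<and> R \<subseteq> {1..n} \<and> L \<noteq> {} \<and> R \<noteq> {} \<and> L \<inter> R = {}"

text \<open>The outcome when each coin \<open>x\<close> is assumed to weigh \<open>w x\<close> grams:
  \<open>-1\<close> if the left cup is lighter, \<open>0\<close> if the scale balances, \<open>1\<close> if the left cup is heavier.\<close>

definition outcome :: "(nat \<Rightarrow> nat) \<Rightarrow> nat set \<Rightarrow> nat set \<Rightarrow> int" where
  "outcome w L R = sgn (int (\<Sum>x\<in>L. w x) - int (\<Sum>x\<in>R. w x))"

text \<open>Coins are identified with their true weights, so the true assignment is \<open>id\<close>.\<close>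

definition determines_weight :: "nat \<Rightarrow> nat set \<Rightarrow> nat set \<Rightarrow> nat \<Rightarrow> bool" where
  "determines_weight n L R k \<longleftrightarrow>
     (\<forall>\<sigma>. \<sigma> permutes {1..n} \<longrightarrow> outcome \<sigma> L R = outcome id L R \<longrightarrow> \<sigma> k = k)"

end

theory Submission
  imports Defs
begin

text \<open>
  Sufficiency rests on extremality. Among the sets of its size, \<open>{1..i}\<close> is the only one of least
  sum and \<open>{j..n}\<close> the only one of greatest sum. If the two cups are these sets and the second
  weighs as much as the first or one gram more, a rearrangement with the same outcome has no room to
  raise the first sum or to lower the second, so it maps each cup to itself; a coin that is alone in its cup, or alone
  off the scale, is then fixed (\<open>extremal_weighing_determines\<close>).

  For necessity, let coin \<open>k\<close> be determined. Swapping \<open>k\<close> with another coin in the same place (same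
  cup, or both off the scale) changes nothing, so \<open>k\<close> is alone in its place
  (\<open>determined_coin_alone\<close>). Beyond this, only the sets matter: any two disjoint sets of the same
  sizes as the cups are the image of the cups under some permutation, so whenever they give the same
  outcome, they must leave \<open>k\<close> in its place (\<open>determined_coin_stays\<close>). All that remains is to
  exhibit, for each weighing that is not extremal, a rearrangement of the cups that moves \<open>k\<close> and
  keeps the outcome.

  If one cup is lighter, every exchange that neither raises it nor lowers the other keeps the
  outcome. Hence \<open>k\<close> is coin \<open>1\<close> on the lighter cup, coin \<open>n\<close> on the heavier one, or a coin off the scale
  that separates the cups; rearrangements that narrow the gap then show that it is one gram. If the scale balances and \<open>k\<close> is alone on a cup, then
  \<open>k\<close> and some coin of the other cup can be shifted by one gram each.

  The hard case is a balanced scale with \<open>k\<close> alone off it. Two kinds of moves put \<open>k\<close> on the scale and keep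
  the balance: a rotation of \<open>k\<close> with two coins that form an arithmetic progression with it, and a
  replacement of one coin by \<open>k\<close> while two others change cups (\<open>no_balancing_move\<close> says that no such
  move puts \<open>k\<close> into a given cup). Without these moves, all the coins on one side of \<open>k\<close> lie in the
  same cup, except perhaps the coin at distance three
  (\<open>one_cup_except_distance_three\<close>). If both sides favour the same cup, the other cup is too light;
  so they favour different cups, and a second use of the moves removes the exceptional coins.
\<close>

section \<open>Sets of extremal sum\<close>

text \<open>The common elements contribute equally to both sums, and the remaining ones can be paired off by a
  bijection that increases every element.\<close>

lemma sum_less_of_symmetric_difference:
  fixes A B :: "nat set"
  assumes "finite A" "finite B" "card A = card B" "A \<noteq> B"
    and less: "\<And>a b. a \<in> A - B \<Longrightarrow> b \<in> B - A \<Longrightarrow> a < b"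
  shows "\<Sum>A < \<Sum>B"
proof -
  have card_eq: "card (A - B) = card (B - A)"
    using assms(1-3) by (metis card_le_sym_Diff le_antisym le_refl)
  then obtain f where f: "bij_betw f (A - B) (B - A)"
    using assms(1,2) finite_same_card_bij by blast
  have "A - B \<noteq> {}"
    using card_eq assms(1,2,4) by (metis Diff_eq_empty_iff card_0_eq finite_Diff subset_antisym card.empty)
  then have "\<Sum>(A - B) < (\<Sum>a\<in>A - B. f a)"
    using assms(1) f less by (intro sum_strict_mono) (auto dest: bij_betwE)
  also have "\<dots> = \<Sum>(B - A)"
    using f by (rule sum.reindex_bij_betw)
  finally show ?thesis
    using sum.Int_Diff[OF assms(1), of "\<lambda>x. x" B] sum.Int_Diff[OF assms(2), of "\<lambda>x. x" A]
    by (simp add: Int_commute)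
qed

lemma initial_segment_minimal:
  fixes S :: "nat set"
  assumes "S \<subseteq> {1..n}" "card S = i"
  shows "\<Sum>{1..i} \<le> \<Sum>S" and "\<Sum>S = \<Sum>{1..i} \<Longrightarrow> S = {1..i}"
proof -
  have "finite S" using assms(1) finite_subset by blast
  then have "S \<noteq> {1..i} \<Longrightarrow> \<Sum>{1..i} < \<Sum>S"
    using assms by (intro sum_less_of_symmetric_difference) auto
  then show "\<Sum>{1..i} \<le> \<Sum>S" and "\<Sum>S = \<Sum>{1..i} \<Longrightarrow> S = {1..i}"
    by fastforce+
qed

lemma final_segment_maximal:
  fixes S :: "nat set"
  assumes "S \<subseteq> {1..n}" "card S = card {j..n}"
  shows "\<Sum>S \<le> \<Sum>{j..n}" and "\<Sum>S = \<Sum>{j..n} \<Longrightarrow> S = {j..n}"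
proof -
  have "finite S" using assms(1) finite_subset by blast
  then have "S \<noteq> {j..n} \<Longrightarrow> \<Sum>S < \<Sum>{j..n}"
    using assms by (intro sum_less_of_symmetric_difference) auto
  then show "\<Sum>S \<le> \<Sum>{j..n}" and "\<Sum>S = \<Sum>{j..n} \<Longrightarrow> S = {j..n}"
    by fastforce+
qed

section \<open>Outcomes\<close>

lemma sum_permutes_image:
  fixes \<sigma> :: "nat \<Rightarrow> nat"
  assumes "\<sigma> permutes S"
  shows "(\<Sum>x\<in>A. \<sigma> x) = \<Sum>(\<sigma> ` A)"
  using assms by (simp add: sum.reindex permutes_inj_on)

text \<open>Comparing the sums in both directions avoids signs of integer differences; the rest of the
  argument uses outcomes only in this form.\<close>

lemma outcome_eq_true_outcome_iff:
  assumes "\<sigma> permutes S"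
  shows "outcome \<sigma> L R = outcome id L R \<longleftrightarrow>
    (\<Sum>(\<sigma> ` L) < \<Sum>(\<sigma> ` R) \<longleftrightarrow> \<Sum>L < \<Sum>R) \<and> (\<Sum>(\<sigma> ` R) < \<Sum>(\<sigma> ` L) \<longleftrightarrow> \<Sum>R < \<Sum>L)"
proof -
  have "sgn (int a - int b) = sgn (int c - int d) \<longleftrightarrow> (a < b \<longleftrightarrow> c < d) \<and> (b < a \<longleftrightarrow> d < c)"
    for a b c d :: nat
    by (auto simp: sgn_if)
  then show ?thesis
    unfolding outcome_def sum_permutes_image[OF assms] id_apply by blast
qed

lemma outcome_swap: "outcome w R L = - outcome w L R"
  unfolding outcome_def by (simp add: sgn_if)

lemma determines_weight_swap:
  "determines_weight n R L k \<longleftrightarrow> determines_weight n L R k"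
  unfolding determines_weight_def by (simp add: outcome_swap[of _ R L])

lemma weighing_swap: "weighing n R L \<longleftrightarrow> weighing n L R"
  unfolding weighing_def by blast

section \<open>Extremal weighings determine a coin\<close>

text \<open>The cups are ordered here: \<open>A\<close> is the one with the light coins.\<close>

definition extremal_weighing :: "nat \<Rightarrow> nat set \<Rightarrow> nat set \<Rightarrow> bool" where
  "extremal_weighing n A B \<longleftrightarrow>
     (\<exists>i\<in>{1..n}. A = {1..i}) \<and> (\<exists>j\<in>{1..n}. B = {j..n}) \<and>
     (\<Sum>A = \<Sum>B \<or> \<Sum>A + 1 = \<Sum>B) \<and>
     (card A = 1 \<or> card B = 1 \<or> card ({1..n} - (A \<union> B)) = 1)"

text \<open>A rearrangement cannot lower the sum of the lighter cup or raise that of the heavier one, and the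
  same outcome leaves a gap of at most one gram; so both sums, hence both sets, are preserved.\<close>

lemma extremal_weighing_determines:
  assumes "extremal_weighing n L R"
  shows "\<exists>k\<in>{1..n}. determines_weight n L R k"
proof -
  obtain i j where i: "L = {1..i}" "i \<in> {1..n}" and j: "R = {j..n}" "j \<in> {1..n}"
    and bal: "\<Sum>L = \<Sum>R \<or> \<Sum>L + 1 = \<Sum>R"
    and single: "card L = 1 \<or> card R = 1 \<or> card ({1..n} - (L \<union> R)) = 1"
    using assms unfolding extremal_weighing_def by blast
  have cups: "L \<subseteq> {1..n}" "R \<subseteq> {1..n}" using i j by auto
  have stable: "\<sigma> ` L = L \<and> \<sigma> ` R = R"
    if \<sigma>: "\<sigma> permutes {1..n}" "outcome \<sigma> L R = outcome id L R" for \<sigma>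
  proof -
    have sub: "\<sigma> ` L \<subseteq> {1..n}" "\<sigma> ` R \<subseteq> {1..n}"
      using cups permutes_image[OF \<sigma>(1)] by blast+
    have card: "card (\<sigma> ` L) = i" "card (\<sigma> ` R) = card {j..n}"
      using \<sigma>(1) i j by (simp_all add: card_image permutes_inj_on)
    have le: "\<Sum>L \<le> \<Sum>(\<sigma> ` L)" "\<Sum>(\<sigma> ` R) \<le> \<Sum>R"
      using initial_segment_minimal(1)[OF sub(1) card(1)]
        final_segment_maximal(1)[OF sub(2) card(2)] i j by simp_all
    have "\<Sum>(\<sigma> ` L) = \<Sum>L \<and> \<Sum>(\<sigma> ` R) = \<Sum>R"
      using \<sigma>(2) le bal unfolding outcome_eq_true_outcome_iff[OF \<sigma>(1)] by linarith
    then show ?thesis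
      using initial_segment_minimal(2)[OF sub(1) card(1)]
        final_segment_maximal(2)[OF sub(2) card(2)] i j by simp
  qed
  from single obtain k C where C: "C = {k}" "C = L \<or> C = R \<or> C = {1..n} - (L \<union> R)"
    by (metis card_1_singletonE)
  have "determines_weight n L R k"
    unfolding determines_weight_def
  proof (intro allI impI)
    fix \<sigma> assume \<sigma>: "\<sigma> permutes {1..n}" "outcome \<sigma> L R = outcome id L R"
    have "\<sigma> ` ({1..n} - (L \<union> R)) = {1..n} - (L \<union> R)"
      using stable[OF \<sigma>] permutes_inj[OF \<sigma>(1)] permutes_image[OF \<sigma>(1)]
      by (simp add: image_set_diff image_Un)
    then have "\<sigma> ` C = C" using C(2) stable[OF \<sigma>] by auto
    then show "\<sigma> k = k" using C(1) by simp
  qed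
  moreover have "k \<in> {1..n}" using C cups by auto
  ultimately show ?thesis by blast
qed

section \<open>What a determined coin excludes\<close>

text \<open>Bijections between the given pairs of sets, and between their complements in \<open>S\<close>, are glued together.\<close>

lemma exists_permutation_moving_two_sets:
  assumes "finite S" and sub: "A \<subseteq> S" "B \<subseteq> S" "A' \<subseteq> S" "B' \<subseteq> S"
    and disj: "A \<inter> B = {}" "A' \<inter> B' = {}"
    and card: "card A' = card A" "card B' = card B"
  shows "\<exists>\<sigma>. \<sigma> permutes S \<and> \<sigma> ` A = A' \<and> \<sigma> ` B = B'"
proof -
  have fin: "finite A" "finite B" "finite A'" "finite B'"
    using assms(1) sub finite_subset by blast+
  obtain f where f: "bij_betw f A A'"
    using fin card(1) by (metis finite_same_card_bij)
  obtain g where g: "bij_betw g B B'"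
    using fin card(2) by (metis finite_same_card_bij)
  have "card (S - (A \<union> B)) = card (S - (A' \<union> B'))"
    using assms fin by (simp add: card_Diff_subset card_Un_disjoint)
  then obtain h where h: "bij_betw h (S - (A \<union> B)) (S - (A' \<union> B'))"
    using assms(1) finite_same_card_bij by (metis finite_Diff)
  define \<sigma> where "\<sigma> x = (if x \<in> A then f x else if x \<in> B then g x else if x \<in> S then h x else x)" for x
  have A: "bij_betw \<sigma> A A'"
    using f by (rule bij_betw_cong[THEN iffD1, rotated]) (simp add: \<sigma>_def)
  have B: "bij_betw \<sigma> B B'"
    using g disj by (intro bij_betw_cong[THEN iffD1, OF _ g]) (auto simp: \<sigma>_def)
  have O: "bij_betw \<sigma> (S - (A \<union> B)) (S - (A' \<union> B'))"
    by (intro bij_betw_cong[THEN iffD1, OF _ h]) (auto simp: \<sigma>_def)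
  have "bij_betw \<sigma> ((A \<union> B) \<union> (S - (A \<union> B))) ((A' \<union> B') \<union> (S - (A' \<union> B')))"
    using A B O disj by (intro bij_betw_combine) auto
  then have "bij_betw \<sigma> S S"
    using sub by (simp add: Un_absorb1 Un_absorb2)
  then have "\<sigma> permutes S"
    using sub by (intro bij_imp_permutes) (auto simp: \<sigma>_def)
  then show ?thesis
    using A B by (auto simp: bij_betw_def)
qed

text \<open>The transposition of two coins in the same place maps each cup to itself.\<close>

lemma determined_coin_alone:
  assumes det: "determines_weight n L R k" and "k \<in> {1..n}" "x \<in> {1..n}"
    and same: "k \<in> L \<longleftrightarrow> x \<in> L" "k \<in> R \<longleftrightarrow> x \<in> R"
  shows "x = k"
proof -
  let ?\<sigma> = "transpose k x"
  have \<sigma>: "?\<sigma> permutes {1..n}"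
    using assms by (intro permutes_swap_id)
  have "?\<sigma> ` L = L" "?\<sigma> ` R = R"
    using same by (simp_all add: transpose_image_eq)
  then have "outcome ?\<sigma> L R = outcome id L R"
    unfolding outcome_eq_true_outcome_iff[OF \<sigma>] by simp
  then have "?\<sigma> k = k"
    using det \<sigma> unfolding determines_weight_def by blast
  then show ?thesis by simp
qed

text \<open>This lemma replaces permutations by sets: to refute that \<open>k\<close> is determined, it suffices to name new
  cups of the right sizes and outcome in which \<open>k\<close> has changed place.\<close>

lemma determined_coin_stays:
  assumes det: "determines_weight n L R k" and w: "weighing n L R"
    and sub: "L' \<subseteq> {1..n}" "R' \<subseteq> {1..n}" "L' \<inter> R' = {}"
    and card: "card L' = card L" "card R' = card R"
    and same: "\<Sum>L' < \<Sum>R' \<longleftrightarrow> \<Sum>L < \<Sum>R" "\<Sum>R' < \<Sum>L' \<longleftrightarrow> \<Sum>R < \<Sum>L"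
  shows "k \<in> L' \<longleftrightarrow> k \<in> L" and "k \<in> R' \<longleftrightarrow> k \<in> R"
proof -
  obtain \<sigma> where \<sigma>: "\<sigma> permutes {1..n}" "\<sigma> ` L = L'" "\<sigma> ` R = R'"
    using exists_permutation_moving_two_sets[of "{1..n}" L R L' R'] w sub card
    unfolding weighing_def by blast
  have "outcome \<sigma> L R = outcome id L R"
    unfolding outcome_eq_true_outcome_iff[OF \<sigma>(1)] using \<sigma> same by simp
  then have "\<sigma> k = k"
    using det \<sigma>(1) unfolding determines_weight_def by blast
  then show "k \<in> L' \<longleftrightarrow> k \<in> L" and "k \<in> R' \<longleftrightarrow> k \<in> R"
    using \<sigma> inj_image_mem_iff[OF permutes_inj[OF \<sigma>(1)], of k] by auto
qed

section \<open>Rearranging a single cup\<close>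

lemma exchange:
  fixes A :: "nat set"
  assumes "finite A" "a \<in> A" "b \<notin> A"
  shows "card (insert b (A - {a})) = card A"
    and "\<Sum>(insert b (A - {a})) + a = \<Sum>A + b"
proof -
  show "card (insert b (A - {a})) = card A"
    using assms card.remove[OF assms(1,2)] by simp
  show "\<Sum>(insert b (A - {a})) + a = \<Sum>A + b"
    using assms sum.remove[OF assms(1,2), of "\<lambda>x. x"] by simp
qed

text \<open>This is the form in which initial segments arise: a gap right below a coin in the cup would allow a
  shift of that coin by one gram.\<close>

lemma initial_segmentI:
  fixes A :: "nat set"
  assumes "A \<subseteq> {1..n}" "A \<noteq> {}"
    and pred: "\<And>x. Suc x \<in> A \<Longrightarrow> x \<ge> 1 \<Longrightarrow> x \<in> A"
  shows "\<exists>i\<in>{1..n}. A = {1..i}"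
proof -
  have fin: "finite A" using assms(1) finite_subset by blast
  have Max: "Max A \<in> A" using fin assms(2) by simp
  have "x \<in> A" if "1 \<le> x" "x \<le> Max A" for x
    using that(2,1)
  proof (induction rule: inc_induct)
    case base
    show ?case by (rule Max)
  next
    case (step m)
    then show ?case using pred by simp
  qed
  then have "A = {1..Max A}" using fin assms(1) by auto
  then show ?thesis using Max assms(1) by blast
qed

section \<open>Unbalanced weighings\<close>

text \<open>Exchanging the lone coin of the lighter cup for a smaller one keeps the outcome, so it is coin \<open>1\<close>.
  As soon as \<open>n \<ge> 3\<close>, some other coin can take its place there with the cup still lighter.\<close>

lemma lighter_determined_left:
  assumes det: "determines_weight n L R k" and w: "weighing n L R"
    and L: "L = {k}" and lt: "\<Sum>L < \<Sum>R"
  shows "k = 1" and "R = {2}" and "n = 2"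
proof -
  note W = w[unfolded weighing_def]
  have fin: "finite R" using W finite_subset by blast
  have stays: "k \<in> L'"
    if "L' \<subseteq> {1..n}" "R' \<subseteq> {1..n}" "L' \<inter> R' = {}" "card L' = 1" "card R' = card R" "\<Sum>L' < \<Sum>R'"
    for L' R'
    using determined_coin_stays(1)[OF det w, of L' R'] that lt L by simp
  show k: "k = 1"
  proof (rule ccontr)
    assume k: "k \<noteq> 1"
    show False
    proof (cases "1 \<in> R")
      case True
      then show False
        using stays[of "{1}" "insert k (R - {1})"] W L k lt exchange[OF fin True, of k] by auto
    next
      case False
      then show False
        using stays[of "{1}" R] W L k lt by auto
    qed
  qed
  have unique: "x = y" if "x \<in> R" "y \<in> R" for x y
  proof -
    have False if xy: "x \<in> R" "y \<in> R" "x < y" for x y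
    proof -
      have "\<Sum>{x, y} \<le> \<Sum>R" using xy fin by (intro sum_mono2) auto
      moreover have "x \<in> {1..n}" "R - {x} \<subseteq> {1..n}" using W xy by blast+
      ultimately show False
        using stays[of "{x}" "insert 1 (R - {x})"] W L k xy exchange[OF fin xy(1), of 1] by auto
    qed
    then show ?thesis using that by (metis linorder_neqE_nat)
  qed
  obtain r where r: "R = {r}" using unique W by auto
  then have "r \<in> {1..n}" "r \<noteq> 1" using W L k by auto
  moreover have "\<not> n \<ge> 3"
    using stays[of "{2}" "{3}"] r k by auto
  ultimately show "n = 2" "R = {2}" using r by auto
qed

text \<open>Exchanging the lone coin of the heavier cup for a bigger one keeps the outcome, so it is coin \<open>n\<close>.
  Coin \<open>n - 1\<close> in its place must not outweigh any rearrangement of the other cup. If \<open>n - 1\<close> is in the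
  lighter cup, it is alone there, and \<open>n = 2\<close>; otherwise the lighter cup weighs exactly \<open>n - 1\<close> grams
  and has no gap that would let it lose a gram.\<close>

lemma lighter_determined_right:
  assumes det: "determines_weight n L R k" and w: "weighing n L R"
    and R: "R = {k}" and lt: "\<Sum>L < \<Sum>R"
  shows "k = n" and "\<exists>i\<in>{1..n}. L = {1..i}" and "\<Sum>L + 1 = \<Sum>R"
proof -
  note W = w[unfolded weighing_def]
  have fin: "finite L" using W finite_subset by blast
  have stays: "k \<in> R'"
    if "L' \<subseteq> {1..n}" "R' \<subseteq> {1..n}" "L' \<inter> R' = {}" "card L' = card L" "card R' = 1" "\<Sum>L' < \<Sum>R'"
    for L' R'
    using determined_coin_stays(2)[OF det w, of L' R'] that lt R by simp
  show k: "k = n"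
  proof (rule ccontr)
    assume k: "k \<noteq> n"
    show False
    proof (cases "n \<in> L")
      case True
      then have "n < k" using lt R member_le_sum[of n L "\<lambda>x. x"] fin by simp
      then show False using W R by auto
    next
      case False
      then show False
        using stays[of L "{n}"] W R k lt by auto
    qed
  qed
  have n2: "n \<ge> 2" 
  proof -
    obtain x where "x \<in> L" using W by auto
    then have "x \<in> {1..n}" "x \<noteq> n" using W R k by auto
    then show ?thesis by auto
  qed
  have "\<exists>i\<in>{1..n}. L = {1..i} \<and> \<Sum>L + 1 = \<Sum>R"
  proof (cases "n - 1 \<in> L")
    case True
    have L1: "L = {n - 1}"
    proof (rule ccontr)
      assume "L \<noteq> {n - 1}"
      then obtain x where x: "x \<in> L" "x \<noteq> n - 1" using True by auto
      have "\<Sum>{x, n - 1} \<le> \<Sum>L" using x True fin by (intro sum_mono2) auto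
      moreover have "x \<ge> 1" using x W by auto
      ultimately show False using x lt R k by simp
    qed
    have "\<not> n \<ge> 3"
    proof
      assume "n \<ge> 3"
      then have "1 < n - 1" "n - 1 < n" "1 \<le> n" by linarith+
      then show False using stays[of "{1}" "{n - 1}"] L1 k by auto
    qed
    then have "n = 2" using n2 by simp
    then show ?thesis using L1 R k by auto
  next
    case False
    have "\<not> \<Sum>L < n - 1"
      using stays[of L "{n - 1}"] W False n2 k by auto
    then have S: "\<Sum>L + 1 = n" using lt R k by simp
    have "\<exists>i\<in>{1..n}. L = {1..i}"
    proof (rule initial_segmentI)
      fix x assume x: "Suc x \<in> L" "x \<ge> 1"
      show "x \<in> L"
      proof (rule ccontr)
        assume xL: "x \<notin> L"
        let ?L = "insert x (L - {Suc x})"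
        have x': "Suc x \<in> {1..n}" "Suc x \<noteq> n" "n \<notin> L" using x W R k by blast+
        then have "x \<in> {1..n}" "x \<noteq> n - 1" using x by auto
        then have sub: "?L \<subseteq> {1..n}" "{n - 1} \<subseteq> {1..n}" "?L \<inter> {n - 1} = {}"
          using W False n2 by auto
        note ex = exchange[OF fin x(1) xL]
        have "\<Sum>?L < \<Sum>{n - 1}" using ex(2) S by simp
        then have "k \<in> {n - 1}" using stays[OF sub ex(1)] by simp
        then show False using k n2 by simp
      qed
    qed (use W in auto)
    then show ?thesis using S R k by auto
  qed
  then show "\<exists>i\<in>{1..n}. L = {1..i}" and "\<Sum>L + 1 = \<Sum>R" by auto
qed

text \<open>Exchanging \<open>k\<close> for a bigger coin of the lighter cup, or for a smaller coin of the heavier cup, keeps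
  the outcome; so \<open>k\<close> separates the cups. Exchanging \<open>k\<close> for coin \<open>k + 1\<close> of the heavier cup costs that
  cup one gram only, which must be enough to spoil the outcome.\<close>

lemma lighter_determined_off:
  assumes det: "determines_weight n L R k" and w: "weighing n L R"
    and O: "{1..n} - (L \<union> R) = {k}" and lt: "\<Sum>L < \<Sum>R"
  shows "L = {1..<k}" and "R = {k<..n}" and "\<Sum>L + 1 = \<Sum>R"
proof -
  note W = w[unfolded weighing_def]
  have fin: "finite L" "finite R" using W finite_subset by blast+
  have k: "k \<in> {1..n}" "k \<notin> L" "k \<notin> R" using O by auto
  have stays: "k \<notin> L' \<and> k \<notin> R'"
    if "L' \<subseteq> {1..n}" "R' \<subseteq> {1..n}" "L' \<inter> R' = {}" "card L' = card L" "card R' = card R" "\<Sum>L' < \<Sum>R'"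
    for L' R'
    using determined_coin_stays[OF det w, of L' R'] that lt k by simp
  have R: "k < x" if x: "x \<in> R" for x
  proof (rule ccontr)
    assume "\<not> k < x"
    then have "x < k" using k x by (metis linorder_neqE_nat)
    have sub: "L \<subseteq> {1..n}" "insert k (R - {x}) \<subseteq> {1..n}" "L \<inter> insert k (R - {x}) = {}"
      using W k by blast+
    note ex = exchange[OF fin(2) x k(3)]
    have "\<Sum>L < \<Sum>(insert k (R - {x}))" using ex(2) lt \<open>x < k\<close> by linarith
    then show False using stays[OF sub refl ex(1)] by blast
  qed
  have L: "x < k" if x: "x \<in> L" for x
  proof (rule ccontr)
    assume "\<not> x < k"
    then have "k < x" using k x by (metis linorder_neqE_nat)
    have sub: "insert k (L - {x}) \<subseteq> {1..n}" "R \<subseteq> {1..n}" "insert k (L - {x}) \<inter> R = {}"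
      using W k by blast+
    note ex = exchange[OF fin(1) x k(2)]
    have "\<Sum>(insert k (L - {x})) < \<Sum>R" using ex(2) lt \<open>k < x\<close> by linarith
    then show False using stays[OF sub ex(1) refl] by blast
  qed
  have all: "x \<in> L \<or> x \<in> R" if "x \<in> {1..n}" "x \<noteq> k" for x
    using O that by blast
  show LR: "L = {1..<k}" "R = {k<..n}"
  proof -
    have "x \<in> L \<longleftrightarrow> x \<in> {1..<k}" "x \<in> R \<longleftrightarrow> x \<in> {k<..n}" for x
      using L[of x] R[of x] all[of x] subsetD[of L "{1..n}" x] subsetD[of R "{1..n}" x] W k by auto
    then show "L = {1..<k}" "R = {k<..n}" by blast+
  qed
  have k1: "Suc k \<in> R" using LR W by auto
  have sub: "L \<subseteq> {1..n}" "insert k (R - {Suc k}) \<subseteq> {1..n}" "L \<inter> insert k (R - {Suc k}) = {}"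
    using W k by blast+
  note ex = exchange[OF fin(2) k1 k(3)]
  have "\<not> \<Sum>L < \<Sum>(insert k (R - {Suc k}))"
    using stays[OF sub refl ex(1)] by blast
  then have "\<not> \<Sum>L + 1 < \<Sum>R" using ex(2) by linarith
  then show "\<Sum>L + 1 = \<Sum>R" using lt by simp
qed

section \<open>Balanced weighings: the determined coin is alone on a cup\<close>

text \<open>If \<open>k < n\<close>, replace \<open>k\<close> by \<open>k + 1\<close> and raise the largest coin of the other cup by one as well. If
  \<open>k = n\<close> and the other cup has a gap right below one of its coins, lower both cups by one gram.\<close>

lemma balanced_determined_cup:
  assumes det: "determines_weight n L R k" and w: "weighing n L R"
    and L: "L = {k}" and eq: "\<Sum>L = \<Sum>R"
  shows "k = n" and "\<exists>i\<in>{1..n}. R = {1..i}"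
proof -
  note W = w[unfolded weighing_def]
  have fin: "finite R" using W finite_subset by blast
  have sR: "\<Sum>R = k" using L eq by simp
  have kn: "k \<in> {1..n}" "k \<notin> R" using L W by auto
  have stays: "k \<in> L'"
    if "L' \<subseteq> {1..n}" "R' \<subseteq> {1..n}" "L' \<inter> R' = {}" "card L' = 1" "card R' = card R" "\<Sum>L' = \<Sum>R'"
    for L' R'
    using determined_coin_stays(1)[OF det w, of L' R'] that eq L by simp
  have le: "x < k" if "x \<in> R" for x
    using member_le_sum[of x R "\<lambda>x. x"] that fin sR kn by (metis le_neq_implies_less zero_le)
  show k: "k = n"
  proof (rule ccontr)
    assume "k \<noteq> n"
    then have lt: "Suc k \<le> n" using kn by auto
    define m where "m = Max R"
    have m: "m \<in> R" "Suc m \<notin> R"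
      using fin W unfolding m_def by (auto dest: Max_ge[OF fin])
    let ?R = "insert (Suc m) (R - {m})"
    have "m < k" using le[OF m(1)] .
    then have sub: "{Suc k} \<subseteq> {1..n}" "?R \<subseteq> {1..n}" "{Suc k} \<inter> ?R = {}"
      using W lt le[of "Suc k"] by auto
    note ex = exchange[OF fin m]
    have "\<Sum>{Suc k} = \<Sum>?R" using ex(2) sR by simp
    then have "k \<in> {Suc k}" using stays[OF sub _ ex(1)] by simp
    then show False by simp
  qed
  show "\<exists>i\<in>{1..n}. R = {1..i}"
  proof (rule initial_segmentI)
    fix x assume x: "Suc x \<in> R" "x \<ge> 1"
    show "x \<in> R"
    proof (rule ccontr)
      assume xR: "x \<notin> R"
      \<comment> \<open>The new left coin must be free: together with \<open>Suc x\<close> it would make the right cup too heavy.\<close>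
      have off: "n - 1 \<notin> insert x (R - {Suc x})"
      proof
        assume "n - 1 \<in> insert x (R - {Suc x})"
        then have "n - 1 \<in> R" "n - 1 \<noteq> Suc x" using le[OF x(1)] k by auto
        moreover from this have "\<Sum>{Suc x, n - 1} \<le> \<Sum>R"
          using x fin by (intro sum_mono2) auto
        ultimately show False using x sR k by simp
      qed
      have "Suc x < n" using le[OF x(1)] k by simp
      then have sub: "{n - 1} \<subseteq> {1..n}" "insert x (R - {Suc x}) \<subseteq> {1..n}"
        "{n - 1} \<inter> insert x (R - {Suc x}) = {}"
        using W off x by auto
      note ex = exchange[OF fin x(1) xR]
      have "\<Sum>{n - 1} = \<Sum>(insert x (R - {Suc x}))" using ex(2) sR k by simp
      then have "k \<in> {n - 1}" using stays[OF sub _ ex(1)] by simp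
      then show False using k \<open>Suc x < n\<close> by simp
    qed
  qed (use W in auto)
qed

section \<open>Balanced weighings: the determined coin is alone off the scale\<close>

text \<open>The two equations say that a move of the coin \<open>k\<close> onto the cup \<open>X\<close> keeps the balance. In the first
  move, \<open>k\<close> replaces \<open>a\<close>, which replaces \<open>b\<close> in \<open>Y\<close>, so the cups change by \<open>k - a\<close> and \<open>a - b\<close>. In the
  second one, \<open>k\<close> replaces \<open>x\<close> while \<open>a\<close> and \<open>b\<close> change cups, so the cups change by \<open>k - x + b - a\<close>
  and \<open>a - b\<close>. Both equations depend only on positions relative to \<open>k\<close> and are invariant under
  reflection in \<open>k\<close>.\<close>

definition no_balancing_move :: "nat \<Rightarrow> nat set \<Rightarrow> nat set \<Rightarrow> bool" where
  "no_balancing_move k X Y \<longleftrightarrow>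
     (\<forall>a\<in>X. \<forall>b\<in>Y. k + b \<noteq> 2 * a) \<and>
     (\<forall>x\<in>X. \<forall>a\<in>X. \<forall>b\<in>Y. x \<noteq> a \<longrightarrow> k + 2 * b \<noteq> x + 2 * a)"

lemma balanced_determined_no_move:
  assumes det: "determines_weight n L R k" and w: "weighing n L R"
    and k: "k \<in> {1..n}" "k \<notin> L" "k \<notin> R" and eq: "\<Sum>L = \<Sum>R"
  shows "no_balancing_move k L R"
  unfolding no_balancing_move_def
proof (intro conjI ballI impI notI)
  note W = w[unfolded weighing_def]
  have fin: "finite L" "finite R" using W finite_subset by blast+
  have stays: "k \<notin> L'"
    if "L' \<subseteq> {1..n}" "R' \<subseteq> {1..n}" "L' \<inter> R' = {}" "card L' = card L" "card R' = card R" "\<Sum>L' = \<Sum>R'"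
    for L' R'
    using determined_coin_stays(1)[OF det w, of L' R'] that eq k by simp
  {
    fix a b assume ab: "a \<in> L" "b \<in> R" "k + b = 2 * a"
    let ?L = "insert k (L - {a})" and ?R = "insert a (R - {b})"
    have aR: "a \<notin> R" using W ab by blast
    have sub: "?L \<subseteq> {1..n}" "?R \<subseteq> {1..n}" "?L \<inter> ?R = {}" using W ab k by blast+
    note ex = exchange[OF fin(1) ab(1) k(2)] exchange[OF fin(2) ab(2) aR]
    have "\<Sum>?L = \<Sum>?R" using ex(2,4) ab(3) eq by linarith
    then show False using stays[OF sub ex(1,3)] by blast
  next
    fix x a b assume xab: "x \<in> L" "a \<in> L" "b \<in> R" "x \<noteq> a" "k + 2 * b = x + 2 * a"
    let ?M = "insert k (L - {x})"
    let ?L = "insert b (?M - {a})" and ?R = "insert a (R - {b})"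
    have M: "finite ?M" "a \<in> ?M" "b \<notin> ?M" and aR: "a \<notin> R" using W xab k fin by blast+
    have sub: "?L \<subseteq> {1..n}" "?R \<subseteq> {1..n}" "?L \<inter> ?R = {}" using W xab k by blast+
    note ex = exchange[OF fin(1) xab(1) k(2)] exchange[OF M] exchange[OF fin(2) xab(3) aR]
    have "\<Sum>?L = \<Sum>?R" using ex(2,4,6) xab(5) eq by linarith
    moreover have "card ?L = card L" using ex(1,3) by simp
    moreover have "k \<noteq> a" using k xab by blast
    ultimately show False using stays[OF sub _ ex(5)] by blast
  }
qed

text \<open>\<open>P d\<close> and \<open>Q d\<close> say in which cup the coin at distance \<open>d\<close> from \<open>k\<close> lies, on a fixed side of \<open>k\<close>. The
  first move, at distances \<open>1, 2\<close> and \<open>2, 4\<close>, gives \<open>move12\<close> and \<open>move24\<close>. The second move, with \<open>x\<close> at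
  distance \<open>2\<close>, gives \<open>step\<close>: a change of cups from \<open>d\<close> to \<open>d + 1\<close> is impossible unless \<open>a\<close> would be \<open>x\<close>
  itself. Working with distances treats the two sides of \<open>k\<close> alike.\<close>

lemma one_cup_except_distance_three:
  fixes P Q :: "nat \<Rightarrow> bool"
  assumes cover: "\<And>d. 1 \<le> d \<Longrightarrow> d \<le> m \<Longrightarrow> P d \<or> Q d"
    and P1: "P 1"
    and move12: "\<not> (P 1 \<and> Q 2)" and move24: "\<not> (P 2 \<and> Q 4)"
    and step: "\<And>d. P 2 \<Longrightarrow> P d \<Longrightarrow> Q (Suc d) \<Longrightarrow> d = 2"
    and "1 \<le> d" "d \<le> m" "d \<noteq> 3"
  shows "P d"
  using assms(6-8)
proof (induction d rule: less_induct)
  case (less d)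
  consider "d = 1" | "d = 2" | "d = 4" | "d \<ge> 5" using less.prems by linarith
  then show ?case
  proof cases
    case 4
    then have "P 2" "P (d - 1)" using less.IH[of 2] less.IH[of "d - 1"] less.prems by auto
    then have "\<not> Q d" using step[of "d - 1"] 4 by auto
    then show ?thesis using cover less.prems by blast
  qed (use less P1 move12 move24 cover[of d] less.IH[of 2] in auto)
qed

lemma cups_cover_iff:
  assumes "X \<union> Y = {1..n} - {k}"
  shows "z \<in> X \<or> z \<in> Y \<longleftrightarrow> 1 \<le> z \<and> z \<le> n \<and> z \<noteq> k"
proof -
  have "z \<in> X \<union> Y \<longleftrightarrow> 1 \<le> z \<and> z \<le> n \<and> z \<noteq> k" unfolding assms by simp
  then show ?thesis by simp
qed

lemma cup_above_gap:
  assumes cover: "X \<union> Y = {1..n} - {k}" and disj: "X \<inter> Y = {}"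
    and move: "no_balancing_move k X Y"
    and near: "k + 1 \<in> X" and y: "y \<in> Y" "k < y"
  shows "y = k + 3"
proof (rule ccontr)
  assume y3: "y \<noteq> k + 3"
  note mem = cups_cover_iff[OF cover]
  have move1: "k + b \<noteq> 2 * a" if "a \<in> X" "b \<in> Y" for a b
    using move that unfolding no_balancing_move_def by blast
  have move2: "k + 2 * b \<noteq> x + 2 * a" if "x \<in> X" "a \<in> X" "b \<in> Y" "x \<noteq> a" for x a b
    using move that unfolding no_balancing_move_def by blast
  have "k + (y - k) \<in> X"
  proof (rule one_cup_except_distance_three[where m = "n - k" and P = "\<lambda>d. k + d \<in> X" and Q = "\<lambda>d. k + d \<in> Y"])
    show "k + d \<in> X \<or> k + d \<in> Y" if "1 \<le> d" "d \<le> n - k" for d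
      using mem[of "k + d"] that by auto
    show "d = 2" if "k + 2 \<in> X" "k + d \<in> X" "k + Suc d \<in> Y" for d
      using move2[OF that] by auto
    show "y - k \<le> n - k" using mem[of y] y by auto
  qed (use near y y3 move1[of "k + 1" "k + 2"] move1[of "k + 2" "k + 4"] in auto)
  then show False using y disj by auto
qed

lemma cup_below_gap:
  assumes cover: "X \<union> Y = {1..n} - {k}" and disj: "X \<inter> Y = {}"
    and move: "no_balancing_move k X Y"
    and near: "k - 1 \<in> X" and y: "y \<in> Y" "y < k"
  shows "y + 3 = k"
proof (rule ccontr)
  assume y3: "y + 3 \<noteq> k"
  note mem = cups_cover_iff[OF cover]
  have pos: "0 < z" if "z \<in> X \<or> z \<in> Y" for z
    using mem[of z] that by simp
  have move1: "k + b \<noteq> 2 * a" if "a \<in> X" "b \<in> Y" for a b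
    using move that unfolding no_balancing_move_def by blast
  have move2: "k + 2 * b \<noteq> x + 2 * a" if "x \<in> X" "a \<in> X" "b \<in> Y" "x \<noteq> a" for x a b
    using move that unfolding no_balancing_move_def by blast
  have "k - (k - y) \<in> X"
  proof (rule one_cup_except_distance_three[where m = "k - 1" and P = "\<lambda>d. k - d \<in> X" and Q = "\<lambda>d. k - d \<in> Y"])
    show "k - d \<in> X \<or> k - d \<in> Y" if "1 \<le> d" "d \<le> k - 1" for d
      using mem[of "k - d"] mem[of "k - 1"] near that by auto
    show "\<not> (k - 1 \<in> X \<and> k - 2 \<in> Y)"
      using move1[of "k - 1" "k - 2"] pos[of "k - 2"] by auto
    show "\<not> (k - 2 \<in> X \<and> k - 4 \<in> Y)"
      using move1[of "k - 2" "k - 4"] pos[of "k - 4"] by auto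
    show "d = 2" if "k - 2 \<in> X" "k - d \<in> X" "k - Suc d \<in> Y" for d
    proof (rule ccontr)
      assume "d \<noteq> 2"
      have "Suc d < k" "2 < k" using pos[of "k - Suc d"] pos[of "k - 2"] that by simp_all
      then have "k + 2 * (k - Suc d) = (k - 2) + 2 * (k - d)" "k - 2 \<noteq> k - d"
        using \<open>d \<noteq> 2\<close> by linarith+
      then show False using move2[OF that] by blast
    qed
    show "k - y \<le> k - 1" using pos[of y] y by auto
  qed (use near y y3 in auto)
  then show False using y disj by auto
qed

text \<open>On each side of \<open>k\<close>, the cup \<open>Y\<close> has at most the coin at distance three, and where it has this coin,
  \<open>X\<close> has those at distances one and two. The sums are then at most \<open>(k - 3) + (k + 3) = 2 * k\<close> against
  at least \<open>4 * k\<close> if both sides contribute, and one coin against two if only one side does.\<close>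

lemma cup_off_both_neighbours_unbalanced:
  assumes cover: "X \<union> Y = {1..n} - {k}" and disj: "X \<inter> Y = {}" and k: "k \<in> {1..n}"
    and move: "no_balancing_move k X Y"
    and ne: "Y \<noteq> {}" and near: "k - 1 \<notin> Y" "k + 1 \<notin> Y"
  shows "\<Sum>Y < \<Sum>X"
proof -
  note mem = cups_cover_iff[OF cover]
  have "finite (X \<union> Y)" using cover by simp
  then have fin: "finite X" "finite Y" by auto
  have above: "y = k + 3 \<and> k + 1 \<in> X \<and> k + 2 \<in> X" if y: "y \<in> Y" "k < y" for y
  proof -
    have "y \<le> n" using mem[of y] y by simp
    then have k1: "k + 1 \<in> X" using mem[of "k + 1"] near y by simp
    have eq: "z = k + 3" if "z \<in> Y" "k < z" for z
      using cup_above_gap[OF cover disj move k1 that] .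
    have "k + 2 \<in> X \<or> k + 2 \<in> Y" using mem[of "k + 2"] \<open>y \<le> n\<close> eq[OF y] by simp
    then show ?thesis using eq[OF y] eq[of "k + 2"] k1 by auto
  qed
  have below: "y + 3 = k \<and> k - 1 \<in> X \<and> k - 2 \<in> X" if y: "y \<in> Y" "y < k" for y
  proof -
    have "y \<ge> 1" using mem[of y] y by simp
    then have "k - 1 \<in> X \<or> k - 1 \<in> Y" using mem[of "k - 1"] y k by auto
    then have k1: "k - 1 \<in> X" using near by auto
    have eq: "z + 3 = k" if "z \<in> Y" "z < k" for z
      using cup_below_gap[OF cover disj move k1 that] .
    have "k - 2 \<in> X \<or> k - 2 \<in> Y" using mem[of "k - 2"] k \<open>y \<ge> 1\<close> eq[OF y] by auto
    then show ?thesis using eq[OF y] eq[of "k - 2"] k1 by auto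
  qed
  have kY: "k \<notin> Y" using mem[of k] by simp
  have Y: "y = k + 3 \<or> y + 3 = k" if "y \<in> Y" for y
    using above[of y] below[of y] that kY by (metis linorder_neqE_nat)
  have sub: "\<Sum>U \<le> \<Sum>X" if "U \<subseteq> X" for U
    using that fin by (intro sum_mono2) auto
  show ?thesis
  proof (cases "k + 3 \<in> Y")
    case up: True
    have a: "k + 1 \<in> X" "k + 2 \<in> X" using above[OF up] by simp_all
    show ?thesis
    proof (cases "\<exists>y\<in>Y. y + 3 = k")
      case True
      then obtain y where y: "y \<in> Y" "k = y + 3" by auto
      have "Y = {y, y + 6}"
      proof
        show "Y \<subseteq> {y, y + 6}"
        proof
          fix z assume "z \<in> Y"
          then show "z \<in> {y, y + 6}" using Y[of z] y by auto
        qed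
        show "{y, y + 6} \<subseteq> Y" using up y by (simp add: add.commute)
      qed
      moreover have "\<Sum>{y + 1, y + 2, y + 4, y + 5} \<le> \<Sum>X"
      proof (rule sub)
        have "k - 2 = y + 1" "k - 1 = y + 2" "k + 1 = y + 4" "k + 2 = y + 5" "y < k"
          using y(2) by simp_all
        then show "{y + 1, y + 2, y + 4, y + 5} \<subseteq> X"
          using a below[OF y(1)] unfolding \<open>k + 1 = y + 4\<close> \<open>k + 2 = y + 5\<close> by simp
      qed
      ultimately show ?thesis using fin by simp
    next
      case False
      then have "Y = {k + 3}" using Y up by blast
      then show ?thesis using sub[of "{k + 1, k + 2}"] a k by simp
    qed
  next
    case False
    then obtain y where y: "y \<in> Y" "k = y + 3" using ne Y by (metis all_not_in_conv)
    have "z = y" if "z \<in> Y" for z using Y[OF that] False that y by auto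
    then have "Y = {y}" using y by blast
    have "y + 1 = k - 2" "y + 2 = k - 1" "y < k" using y(2) by simp_all
    then have "{y + 1, y + 2} \<subseteq> X" using below[OF y(1)] by simp
    then show ?thesis using sub[of "{y + 1, y + 2}"] \<open>Y = {y}\<close> by simp
  qed
qed

text \<open>The cup containing \<open>k - 1\<close> can have at most \<open>k + 3\<close> above \<open>k\<close>, and the other cup at most \<open>k - 3\<close> below.
  The second move, with \<open>x\<close> on the opposite side of \<open>k\<close> from \<open>a\<close> and \<open>b\<close>, rules out each exception. When
  the opposite side is too short to contain such an \<open>x\<close>, either \<open>x\<close> is taken from the same side, or
  the weighing is one of two small ones that do not balance.\<close>

lemma cups_separated_by_off_coin:
  assumes cover: "X \<union> Y = {1..n} - {k}" and disj: "X \<inter> Y = {}" and k: "k \<in> {1..n}"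
    and move: "no_balancing_move k X Y" "no_balancing_move k Y X"
    and eq: "\<Sum>X = \<Sum>Y" and near: "k - 1 \<in> X" "k + 1 \<in> Y"
  shows "X = {1..<k}" and "Y = {k<..n}"
proof -
  note mem = cups_cover_iff[OF cover]
  have "finite (X \<union> Y)" using cover by simp
  then have fin: "finite X" "finite Y" by auto
  have off: "k \<notin> X" "k \<notin> Y" "0 \<notin> X" "0 \<notin> Y" using mem[of k] mem[of 0] by auto
  then have k2: "k \<ge> 2" using near(1) k by (cases "k = 1") auto
  have cov: "z \<in> X \<or> z \<in> Y" if "1 \<le> z" "z \<le> n" "z \<noteq> k" for z
    using mem[of z] that by simp
  have ranges: "z \<le> n" if "z \<in> X \<or> z \<in> Y" for z
    using mem[of z] that by simp
  have sub: "\<Sum>U \<le> \<Sum>Z" if "U \<subseteq> Z" "Z = X \<or> Z = Y" for U Z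
    using that fin by (intro sum_mono2) auto
  have up: "x = k + 3" if "x \<in> X" "k < x" for x
    using cup_above_gap[OF _ _ move(2) near(2) that] cover disj by (simp add: Un_commute Int_commute)
  have down: "y + 3 = k" if "y \<in> Y" "y < k" for y
    using cup_below_gap[OF cover disj move(1) near(1) that] .
  note M = move[unfolded no_balancing_move_def]
  have X: "x < k" if x: "x \<in> X" for x
  proof (rule ccontr)
    assume "\<not> x < k"
    then have xk: "k < x" using x off by (metis linorder_neqE_nat)
    have k3: "k + 3 \<in> X" using up[OF x xk] x by simp
    have "k + 2 \<in> Y" using cov[of "k + 2"] ranges[of "k + 3"] up[of "k + 2"] k3 by auto
    \<comment> \<open>The move puts \<open>k\<close> in place of \<open>k - 2\<close> and swaps \<open>k + 3\<close> with \<open>k + 2\<close>; if \<open>k = 2\<close>, then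
      \<open>X = {1, 5}\<close> is too light.\<close>
    show False
    proof (cases "k = 2")
      case True
      have "X = {1, 5}"
      proof
        show "X \<subseteq> {1, 5}"
        proof
          fix z assume z: "z \<in> X"
          then have "z \<noteq> 0" "z \<noteq> 2" using off True by metis+
          then show "z \<in> {1, 5}" using up[OF z] True by (cases "z < 2") auto
        qed
        show "{1, 5} \<subseteq> X" using near k3 True by auto
      qed
      moreover have "\<Sum>{3, 4} \<le> \<Sum>Y"
        using near \<open>k + 2 \<in> Y\<close> True by (intro sub) auto
      ultimately show False using eq by simp
    next
      case False
      have "k - 2 \<notin> Y"
      proof
        assume "k - 2 \<in> Y"
        moreover have "k + (k - 2) = 2 * (k - 1)" using k2 by simp
        ultimately show False using M near(1) by blast
      qed
      then have "k - 2 \<in> X" using cov[of "k - 2"] k k2 False by auto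
      moreover have "k + 2 * (k + 2) = (k - 2) + 2 * (k + 3)" using k2 by simp
      moreover have "k - 2 \<noteq> k + 3" by simp
      ultimately show False using M k3 \<open>k + 2 \<in> Y\<close> by metis
    qed
  qed
  have Y: "k < y" if y: "y \<in> Y" for y
  proof (rule ccontr)
    assume "\<not> k < y"
    then have yk: "y < k" using y off by (metis linorder_neqE_nat)
    have k3: "k = y + 3" using down[OF y yk] by simp
    have y1: "y \<ge> 1" using y off by (cases y) auto
    have below: "z \<in> X" if "1 \<le> z" "z < k" "z \<noteq> y" for z
      using cov[of z] down[of z] that k k3 by auto
    \<comment> \<open>Here \<open>y\<close> is swapped with \<open>y + 1\<close>, and \<open>k\<close> takes the place of \<open>k + 2\<close>. If \<open>k + 1\<close> is the
      last coin, \<open>y - 1\<close> makes way for \<open>k\<close> while \<open>y + 2\<close> and \<open>y\<close> are swapped; this needs \<open>y > 1\<close>, and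
      for \<open>y = 1\<close> the cups \<open>{2, 3}\<close> and \<open>{1, 5}\<close> do not balance.\<close>
    show False
    proof (cases "k + 2 \<le> n")
      case True
      then have "k + 2 \<in> Y" using cov[of "k + 2"] X[of "k + 2"] by auto
      moreover have "k + 2 * (y + 1) = (k + 2) + 2 * y" "k + 2 \<noteq> y" using k3 by auto
      moreover have "y + 1 \<in> X" using below k3 by simp
      ultimately show False using M y by metis
    next
      case False
      then have n: "n = k + 1" using ranges[of "k + 1"] near(2) by simp
      show False
      proof (cases "y = 1")
        case True
        have "Y \<subseteq> {1, 5}"
        proof
          fix z assume z: "z \<in> Y"
          then have "z \<noteq> k" "z \<le> n" using off ranges by auto
          then show "z \<in> {1, 5}" using down[OF z] n k3 True by auto
        qed
        moreover have "{1, 5} \<subseteq> Y" using near(2) y k3 True by auto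
        ultimately have Y: "Y = {1, 5}" by blast
        have "X = {2, 3}"
        proof
          show "X \<subseteq> {2, 3}"
          proof
            fix z assume z: "z \<in> X"
            then have "z \<noteq> 0" "z \<noteq> 1" using off y disj True by auto
            then show "z \<in> {2, 3}" using X[OF z] k3 True by auto
          qed
          show "{2, 3} \<subseteq> X" using below[of 2] below[of 3] k3 True by auto
        qed
        then show False using Y eq by simp
      next
        case False
        then have "y - 1 \<in> X" "y + 2 \<in> X" using below[of "y - 1"] below[of "y + 2"] k3 y1 by auto
        moreover have "k + 2 * y = (y - 1) + 2 * (y + 2)" "y - 1 \<noteq> y + 2" using k3 y1 by auto
        ultimately show False using M y by metis
      qed
    qed
  qed
  show "X = {1..<k}"
  proof
    show "X \<subseteq> {1..<k}"
    proof
      fix z assume "z \<in> X"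
      then show "z \<in> {1..<k}" using mem[of z] X[of z] by simp
    qed
    show "{1..<k} \<subseteq> X"
    proof
      fix z assume "z \<in> {1..<k}"
      then show "z \<in> X" using cov[of z] Y[of z] k by auto
    qed
  qed
  show "Y = {k<..n}"
  proof
    show "Y \<subseteq> {k<..n}" using Y ranges by auto
    show "{k<..n} \<subseteq> Y"
    proof
      fix z assume "z \<in> {k<..n}"
      then show "z \<in> Y" using cov[of z] X[of z] k by auto
    qed
  qed
qed

lemma balanced_determined_off:
  assumes det: "determines_weight n L R k" and w: "weighing n L R"
    and O: "{1..n} - (L \<union> R) = {k}" and eq: "\<Sum>L = \<Sum>R"
  shows "L = {1..<k} \<and> R = {k<..n} \<or> R = {1..<k} \<and> L = {k<..n}"
proof -
  have sub: "L \<subseteq> {1..n}" "R \<subseteq> {1..n}" and ne: "L \<noteq> {}" "R \<noteq> {}" and disj: "L \<inter> R = {}" "R \<inter> L = {}"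
    using w unfolding weighing_def by auto
  have k: "k \<in> {1..n}" "k \<notin> L" "k \<notin> R" using O by auto
  have cover: "L \<union> R = {1..n} - {k}" "R \<union> L = {1..n} - {k}" using sub O by auto
  have LR: "no_balancing_move k L R"
    using balanced_determined_no_move[OF det w k eq] .
  have RL: "no_balancing_move k R L"
    using balanced_determined_no_move[of n R L k] det w k eq
    by (simp add: determines_weight_swap weighing_swap)
  have "k - 1 \<in> R \<or> k + 1 \<in> R"
    using cup_off_both_neighbours_unbalanced[OF cover(1) disj(1) k(1) LR ne(2)] eq by auto
  moreover have "k - 1 \<in> L \<or> k + 1 \<in> L"
    using cup_off_both_neighbours_unbalanced[OF cover(2) disj(2) k(1) RL ne(1)] eq by auto
  ultimately consider "k - 1 \<in> L" "k + 1 \<in> R" | "k - 1 \<in> R" "k + 1 \<in> L"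
    using disj by blast
  then show ?thesis
  proof cases
    case 1
    then show ?thesis
      using cups_separated_by_off_coin[OF cover(1) disj(1) k(1) LR RL eq] by blast
  next
    case 2
    then show ?thesis
      using cups_separated_by_off_coin[OF cover(2) disj(2) k(1) RL LR eq[symmetric]] by blast
  qed
qed

lemma segments_around_off_coin:
  assumes "A = {1..<k}" "B = {k<..n}" "A \<noteq> {}" "B \<noteq> {}"
  shows "\<exists>i\<in>{1..n}. A = {1..i}" and "\<exists>j\<in>{1..n}. B = {j..n::nat}"
proof -
  have "A = {1..k - 1}" "k - 1 \<in> {1..n}" "B = {k + 1..n}" "k + 1 \<in> {1..n}"
    using assms by auto
  then show "\<exists>i\<in>{1..n}. A = {1..i}" and "\<exists>j\<in>{1..n}. B = {j..n}" by blast+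
qed

section \<open>The characterisation\<close>

lemma determining_weighing_extremal:
  assumes "k \<in> {1..n}" and det: "determines_weight n L R k" and w: "weighing n L R"
    and le: "\<Sum>L \<le> \<Sum>R"
  shows "extremal_weighing n L R \<or> extremal_weighing n R L"
proof -
  have ne: "L \<noteq> {}" "R \<noteq> {}" and sub: "L \<subseteq> {1..n}" "R \<subseteq> {1..n}" and disj: "L \<inter> R = {}"
    using w unfolding weighing_def by auto
  have alone: "x = k" if "x \<in> {1..n}" "k \<in> L \<longleftrightarrow> x \<in> L" "k \<in> R \<longleftrightarrow> x \<in> R" for x
    using determined_coin_alone[OF det assms(1) that] .
  consider "L = {k}" | "R = {k}" | "{1..n} - (L \<union> R) = {k}"
  proof (cases "k \<in> L"; cases "k \<in> R")
    assume "k \<in> L" "k \<notin> R"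
    then have "L = {k}" using alone sub disj by blast
    then show thesis using that by blast
  next
    assume "k \<notin> L" "k \<in> R"
    then have "R = {k}" using alone sub disj by blast
    then show thesis using that by blast
  next
    assume "k \<notin> L" "k \<notin> R"
    then have "{1..n} - (L \<union> R) = {k}" using alone assms(1) by blast
    then show thesis using that by blast
  qed (use disj in blast)
  note singleton = this
  have final: "\<exists>j\<in>{1..n}. {n} = {j..n}" using assms(1) by (intro bexI[of _ n]) auto
  from le consider "\<Sum>L < \<Sum>R" | "\<Sum>L = \<Sum>R" by linarith
  then show ?thesis
  proof cases
    case lt: 1
    have "extremal_weighing n L R"
      using singleton
    proof cases
      case 1
      note * = lighter_determined_left[OF det w 1 lt]
      have "\<exists>i\<in>{1..n}. L = {1..i}" using 1 * by (intro bexI[of _ 1]) auto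
      then show ?thesis using 1 * final by (simp add: extremal_weighing_def)
    next
      case 2
      note * = lighter_determined_right[OF det w 2 lt]
      then show ?thesis using 2 final by (simp add: extremal_weighing_def)
    next
      case 3
      note * = lighter_determined_off[OF det w 3 lt]
      then show ?thesis using 3 segments_around_off_coin[OF *(1,2) ne] by (simp add: extremal_weighing_def)
    qed
    then show ?thesis ..
  next
    case eq: 2
    from singleton show ?thesis
    proof cases
      case 1
      show ?thesis using balanced_determined_cup[OF det w 1 eq] 1 eq final by (simp add: extremal_weighing_def)
    next
      case 2
      have "determines_weight n R L k" "weighing n R L"
        using det w by (simp_all add: determines_weight_swap weighing_swap)
      from balanced_determined_cup[OF this 2 eq[symmetric]] 
      show ?thesis using 2 eq final by (simp add: extremal_weighing_def)
    next
      case 3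
      have 3: "card ({1..n} - (L \<union> R)) = 1" "card ({1..n} - (R \<union> L)) = 1" 
        using 3 by (simp_all add: Un_commute)
      from balanced_determined_off[OF det w \<open>{1..n} - (L \<union> R) = {k}\<close> eq] show ?thesis
      proof
        assume *: "L = {1..<k} \<and> R = {k<..n}"
        then show ?thesis using segments_around_off_coin[of L k R n] ne 3 eq by (simp add: extremal_weighing_def)
      next
        assume *: "R = {1..<k} \<and> L = {k<..n}"
        then show ?thesis using segments_around_off_coin[of R k L n] ne 3 eq by (simp add: extremal_weighing_def)
      qed
    qed
  qed
qed

theorem theorem4p1:
  fixes n :: nat and L R :: "nat set"
  assumes "n \<ge> 1" and "weighing n L R"
  shows "(\<exists>k\<in>{1..n}. determines_weight n L R k) \<longleftrightarrow>
    (\<exists>A B. (A = L \<and> B = R \<or> A = R \<and> B = L) \<and>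
       (\<exists>i\<in>{1..n}. A = {1..i}) \<and>
       (\<exists>j\<in>{1..n}. B = {j..n}) \<and>
       (\<Sum>A = \<Sum>B \<or> \<Sum>A + 1 = \<Sum>B) \<and>
       (card A = 1 \<or> card B = 1 \<or> card ({1..n} - (A \<union> B)) = 1))"
proof -
  have pair: "(\<exists>A B. (A = L \<and> B = R \<or> A = R \<and> B = L) \<and> P A B) \<longleftrightarrow> P L R \<or> P R L" for P
    by blast
  have swapped: "determines_weight n R L k \<longleftrightarrow> determines_weight n L R k" "weighing n R L" for k
    using assms(2) by (simp_all add: determines_weight_swap weighing_swap)
  have "(\<exists>k\<in>{1..n}. determines_weight n L R k) \<longleftrightarrow> extremal_weighing n L R \<or> extremal_weighing n R L"
  proof
    assume "\<exists>k\<in>{1..n}. determines_weight n L R k"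
    then obtain k where k: "k \<in> {1..n}" and det: "determines_weight n L R k" by blast
    show "extremal_weighing n L R \<or> extremal_weighing n R L"
    proof (rule linorder_le_cases[of "\<Sum>L" "\<Sum>R"])
      assume "\<Sum>L \<le> \<Sum>R"
      then show ?thesis by (rule determining_weighing_extremal[OF k det assms(2)])
    next
      assume "\<Sum>R \<le> \<Sum>L"
      then have "extremal_weighing n R L \<or> extremal_weighing n L R"
        using det swapped by (intro determining_weighing_extremal[OF k]) auto
      then show ?thesis by blast
    qed
  next
    assume "extremal_weighing n L R \<or> extremal_weighing n R L"
    then show "\<exists>k\<in>{1..n}. determines_weight n L R k"
      using extremal_weighing_determines[of n L R] extremal_weighing_determines[of n R L] swapped(1)
      by blast
  qed
  then show ?thesis
    unfolding extremal_weighing_def pair .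
qed

end
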